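(* Let $G$ be a graph with diameter $d$ and let $s,t$ be vertices of $G$. If there exists an alternation strategy such that the bidirectional BFS between $s$ and $t$ explores $f(n)$ edges, then the bidirectional BFS between $s$ and $t$ with greedy alternation strategy explores at most $d\cdot f(n)$ edges.
   Context: $G=(V,E)$ is an undirected, unweighted, connected graph with $n$ vertices. For a vertex $s$, the BFS from $s$ has layers $L^s_0=\{s\}$ and $L^s_{i+1}$ = the neighbors of vertices in $L^s_i$ not contained in earlier layers; computing $L^s_{i+1}$ from $L^s_i$ is an exploration step, which explores the $c^s_i := \sum_{v\in L^s_i}\deg(v)$ edges incident to $L^s_i$. The bidirectional BFS runs a forward BFS from $s$ and a backward BFS from $t$; an alternation strategy decides, after each full exploration step, which of the two searches performs the next exploration step (steps are never interrupted). The bidirectional BFS stops once some vertex has been found by both searches. The greedy alternation strategy: if the latest layers are $L^s_i$ and $L^t_j$, perform the next exploration step in the forward search if $c^s_i \le c^t_j$ and in the backward search otherwise. *)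

theory Defs
  imports "Graph_Theory.Graph_Theory"
begin

definition diameter :: "('a, 'b) pre_digraph \<Rightarrow> ereal" where
  "diameter G = (SUP u\<in>verts G. SUP v\<in>verts G. wf_digraph.\<mu> G (\<lambda>_. 1) u v)"

fun bfs_layer :: "('a, 'b) pre_digraph \<Rightarrow> 'a \<Rightarrow> nat \<Rightarrow> 'a set" where
  "bfs_layer G s 0 = {s}"
| "bfs_layer G s (Suc i) =
     {w. \<exists>v\<in>bfs_layer G s i. v \<rightarrow>\<^bsub>G\<^esub> w} - (\<Union>j\<in>{..i}. bfs_layer G s j)"

text \<open>In a \<^locale>\<open>graph\<close> every undirected edge is a pair of opposite arcs,
  so the degree of a vertex is its out-degree.\<close>

definition layer_cost :: "('a, 'b) pre_digraph \<Rightarrow> 'a \<Rightarrow> nat \<Rightarrow> nat" where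
  "layer_cost G s i = (\<Sum>v\<in>bfs_layer G s i. out_degree G v)"

datatype direction = Forward | Backward

text \<open>A strategy chooses the search performing the next exploration step from the sequence
  of choices made so far. For fixed graph and endpoints this sequence determines everything
  that the two searches have seen, so decisions based on the explored part of the graph
  are covered as well.\<close>

type_synonym strategy = "direction list \<Rightarrow> direction"

primrec history :: "strategy \<Rightarrow> nat \<Rightarrow> direction list" where
  "history A 0 = []"
| "history A (Suc k) = history A k @ [A (history A k)]"

definition found :: "('a, 'b) pre_digraph \<Rightarrow> 'a \<Rightarrow> nat \<Rightarrow> 'a set" where
  "found G s i = (\<Union>j\<in>{..i}. bfs_layer G s j)"

definition searches_met :: "('a, 'b) pre_digraph \<Rightarrow> 'a \<Rightarrow> 'a \<Rightarrow> direction list \<Rightarrow> bool" where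
  "searches_met G s t h \<longleftrightarrow>
     found G s (count_list h Forward) \<inter> found G t (count_list h Backward) \<noteq> {}"

fun step_cost :: "('a, 'b) pre_digraph \<Rightarrow> 'a \<Rightarrow> 'a \<Rightarrow> direction list \<Rightarrow> direction \<Rightarrow> nat" where
  "step_cost G s t h Forward = layer_cost G s (count_list h Forward)"
| "step_cost G s t h Backward = layer_cost G t (count_list h Backward)"

text \<open>In a connected graph the searches always meet after finitely many steps, so the
  least number below exists for every strategy.\<close>

definition bibfs_steps :: "('a, 'b) pre_digraph \<Rightarrow> 'a \<Rightarrow> 'a \<Rightarrow> strategy \<Rightarrow> nat" where
  "bibfs_steps G s t A = (LEAST k. searches_met G s t (history A k))"

definition bibfs_explored :: "('a, 'b) pre_digraph \<Rightarrow> 'a \<Rightarrow> 'a \<Rightarrow> strategy \<Rightarrow> nat" where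
  "bibfs_explored G s t A =
     (\<Sum>k<bibfs_steps G s t A. step_cost G s t (history A k) (A (history A k)))"

definition greedy :: "('a, 'b) pre_digraph \<Rightarrow> 'a \<Rightarrow> 'a \<Rightarrow> strategy" where
  "greedy G s t h =
     (if layer_cost G s (count_list h Forward) \<le> layer_cost G t (count_list h Backward)
      then Forward else Backward)"

end

(* The searches have met as soon as their radii add up to the distance of s and t, so every
   strategy performs exactly dist(s,t) <= d steps. If the greedy searches have expanded i and j
   layers with i + j < dist(s,t), the other strategy must at some point expand layer i around s
   or layer j around t. The greedy step takes the cheaper of these two layers, hence it costs
   at most as much as the whole other search. *)
theory Submission
  imports Defs
begin

text \<open>Distances in \<open>\<mu>\<close> are infima of walk costs in \<open>ereal\<close>, and
  with unit costs these are walk lengths. Walks are turned into powers of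
  \<open>arcs_ends G\<close>, which is what the layers are compared with later.\<close>

lemma diameter_le_imp_short_walk:
  assumes "wf_digraph G" and "diameter G \<le> ereal (real d)"
    and "u \<in> verts G" and "v \<in> verts G"
  shows "\<exists>m\<le>d. (u, v) \<in> arcs_ends G ^^ m"
proof -
  interpret wf_digraph G by fact
  have walk: "(x, y) \<in> arcs_ends G ^^ length p" if "awalk x p y" for x p y
    using that
  proof (induction p arbitrary: x)
    case (Cons e p)
    then have "(x, head G e) \<in> arcs_ends G" and "(head G e, y) \<in> arcs_ends G ^^ length p"
      by (auto simp: awalk_Cons_iff in_arcs_imp_in_arcs_ends)
    then show ?case
      using relpow_Suc_I2 by (metis length_Cons)
  qed (simp add: awalk_Nil_iff)
  have cost: "awalk_cost (\<lambda>_. 1) p = real (length p)" for p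
    by (induction p) auto
  have "\<mu> (\<lambda>_. 1) u v \<le> diameter G"
    unfolding diameter_def using assms(3,4) by (meson SUP_upper2 order_refl)
  \<comment> \<open>A strict bound is needed to extract an actual walk from the infimum; lengths
    being integers, being below \<open>Suc d\<close> loses nothing.\<close>
  also have "\<dots> < ereal (real (Suc d))"
    using assms(2) by (rule le_less_trans) simp
  finally obtain p where "awalk u p v" "length p < Suc d"
    unfolding \<mu>_def INF_less_iff cost by auto
  with walk show ?thesis
    by (metis less_Suc_eq_le)
qed

lemma found_Suc: "found G s (Suc i) = found G s i \<union> {w. \<exists>v\<in>bfs_layer G s i. v \<rightarrow>\<^bsub>G\<^esub> w}"
  by (simp add: found_def atMost_Suc) blast

lemma found_mono: "i \<le> j \<Longrightarrow> found G s i \<subseteq> found G s j"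
  unfolding found_def by (intro UN_mono) auto

text \<open>Expanding only the newest layer is as good as expanding everything found, since
  neighbors of older layers were found earlier. This recursion no longer mentions layers.\<close>

lemma found_Suc_eq: "found G s (Suc i) = found G s i \<union> {w. \<exists>v\<in>found G s i. v \<rightarrow>\<^bsub>G\<^esub> w}"
proof
  show "found G s (Suc i) \<subseteq> found G s i \<union> {w. \<exists>v\<in>found G s i. v \<rightarrow>\<^bsub>G\<^esub> w}"
    unfolding found_Suc by (auto simp: found_def)
  have "w \<in> found G s (Suc i)" if v: "v \<in> found G s i" "v \<rightarrow>\<^bsub>G\<^esub> w" for v w
  proof -
    obtain j where "j \<le> i" "v \<in> bfs_layer G s j"
      using v(1) by (auto simp: found_def)
    then have "w \<in> found G s (Suc j)"
      using v(2) by (auto simp: found_Suc)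
    then show ?thesis
      using found_mono \<open>j \<le> i\<close> by (meson Suc_le_mono subsetD)
  qed
  then show "found G s i \<union> {w. \<exists>v\<in>found G s i. v \<rightarrow>\<^bsub>G\<^esub> w} \<subseteq> found G s (Suc i)"
    using found_mono[of i "Suc i" G s] by auto
qed

lemma in_found_iff: "v \<in> found G s i \<longleftrightarrow> (\<exists>k\<le>i. (s, v) \<in> arcs_ends G ^^ k)"
proof (induction i arbitrary: v)
  case 0
  show ?case by (auto simp: found_def)
next
  case (Suc i)
  show ?case
  proof
    assume "v \<in> found G s (Suc i)"
    then show "\<exists>k\<le>Suc i. (s, v) \<in> arcs_ends G ^^ k"
      unfolding found_Suc_eq using Suc.IH by (auto intro: le_SucI) (meson Suc_le_mono relpow_Suc_I)
  next
    assume "\<exists>k\<le>Suc i. (s, v) \<in> arcs_ends G ^^ k"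
    then obtain k where k: "k \<le> Suc i" "(s, v) \<in> arcs_ends G ^^ k"
      by blast
    show "v \<in> found G s (Suc i)"
    proof (cases k)
      case 0
      then show ?thesis
        using k Suc.IH[of v] by (auto simp: found_Suc_eq)
    next
      case (Suc k')
      then show ?thesis
        using k Suc.IH by (auto simp: found_Suc_eq)
    qed
  qed
qed

lemma count_Forward_Backward: "count_list h Forward + count_list h Backward = length h"
proof (induction h)
  case (Cons a h)
  then show ?case by (cases a) auto
qed simp

lemma length_history [simp]: "length (history A k) = k"
  by (induction k) auto

text \<open>Two balls intersect iff their radii add up to at least the distance of the centers, and
  the two radii always add up to the number of steps. Thus the order of the choices is
  irrelevant.\<close>

lemma searches_met_iff:
  assumes "symmetric G"
  shows "searches_met G s t h \<longleftrightarrow> (\<exists>m\<le>length h. (s, t) \<in> arcs_ends G ^^ m)"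
proof -
  let ?R = "arcs_ends G"
  have sym: "(y, x) \<in> ?R ^^ k" if "(x, y) \<in> ?R ^^ k" for x y k
    using that
  proof (induction k arbitrary: x)
    case (Suc k)
    obtain z where "(x, z) \<in> ?R" "(z, y) \<in> ?R ^^ k"
      using Suc.prems by (meson relpow_Suc_D2)
    then show ?case
      using Suc.IH arcs_ends_symmetric[OF assms] by (meson relpow_Suc_I)
  qed simp
  let ?i = "count_list h Forward" and ?j = "count_list h Backward"
  have len: "length h = ?i + ?j"
    using count_Forward_Backward[of h] by simp
  show ?thesis
  proof
    assume "searches_met G s t h"
    then obtain x k l where "k \<le> ?i" "(s, x) \<in> ?R ^^ k" "l \<le> ?j" "(t, x) \<in> ?R ^^ l"
      by (auto simp: searches_met_def in_found_iff disjoint_iff)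
    then show "\<exists>m\<le>length h. (s, t) \<in> ?R ^^ m"
      unfolding len by (intro exI[of _ "k + l"]) (auto simp: relpow_add dest: sym)
  next
    assume "\<exists>m\<le>length h. (s, t) \<in> ?R ^^ m"
    then obtain m where m: "m \<le> ?i + ?j" "(s, t) \<in> ?R ^^ m"
      unfolding len by blast
    \<comment> \<open>The walk is cut as far from \<open>s\<close> as the forward radius permits, so
      the rest fits into the backward radius.\<close>
    define k where "k = min m ?i"
    have kl: "k \<le> ?i" "m - k \<le> ?j" "m = k + (m - k)"
      using m(1) by (auto simp: k_def)
    then have "(s, t) \<in> ?R ^^ k O ?R ^^ (m - k)"
      using m(2) relpow_add[of k "m - k" ?R] by simp
    then obtain x where "(s, x) \<in> ?R ^^ k" "(x, t) \<in> ?R ^^ (m - k)"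
      by blast
    then have "x \<in> found G s ?i" "x \<in> found G t ?j"
      using kl sym unfolding in_found_iff by blast+
    then show "searches_met G s t h"
      by (auto simp: searches_met_def)
  qed
qed

lemma bibfs_steps_eq:
  assumes "symmetric G" and "\<exists>m. (s, t) \<in> arcs_ends G ^^ m"
  shows "bibfs_steps G s t A = (LEAST m. (s, t) \<in> arcs_ends G ^^ m)"
  unfolding bibfs_steps_def searches_met_iff[OF assms(1)] length_history
proof (rule Least_equality)
  let ?D = "LEAST m. (s, t) \<in> arcs_ends G ^^ m"
  show "\<exists>m\<le>?D. (s, t) \<in> arcs_ends G ^^ m"
    using LeastI_ex[OF assms(2)] by blast
  show "?D \<le> k" if "\<exists>m\<le>k. (s, t) \<in> arcs_ends G ^^ m" for k
    using that by (meson Least_le le_trans)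
qed

text \<open>The count starts at 0 and grows by at most one per step, so it cannot skip
  \<open>i\<close>; the step at which it leaves \<open>i\<close> is the one expanding layer
  \<open>i\<close> in direction \<open>x\<close>.\<close>

lemma history_count_attained:
  assumes "i < count_list (history A k) x"
  shows "\<exists>m<k. count_list (history A m) x = i \<and> A (history A m) = x"
  using assms
proof (induction k)
  case (Suc k)
  show ?case
  proof (cases "i < count_list (history A k) x")
    case True
    then show ?thesis using Suc.IH by (meson less_Suc_eq)
  next
    case False
    \<comment> \<open>Here the last step itself raises the count from \<open>i\<close> to
      \<open>Suc i\<close>.\<close>
    then show ?thesis
      using Suc.prems by (intro exI[of _ k]) (auto split: if_splits)
  qed
qed simp

lemma step_cost_le_explored:
  "m < bibfs_steps G s t A \<Longrightarrow>
     step_cost G s t (history A m) (A (history A m)) \<le> bibfs_explored G s t A"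
  unfolding bibfs_explored_def by (rule member_le_sum) auto

lemma min_layer_cost_le_explored:
  assumes "i + j < bibfs_steps G s t A"
  shows "min (layer_cost G s i) (layer_cost G t j) \<le> bibfs_explored G s t A"
proof -
  let ?h = "history A (bibfs_steps G s t A)"
  \<comment> \<open>Pigeonhole: the two counts sum to the number of steps, which exceeds
    \<open>i + j\<close>.\<close>
  have "i < count_list ?h Forward \<or> j < count_list ?h Backward"
    using assms count_Forward_Backward[of ?h] by simp linarith
  then show ?thesis
  proof
    assume "i < count_list ?h Forward"
    then obtain m where "m < bibfs_steps G s t A" "count_list (history A m) Forward = i"
      "A (history A m) = Forward"
      using history_count_attained by blast
    then show ?thesis
      using step_cost_le_explored[of m G s t A] by (simp add: min.coboundedI1 min.coboundedI2)
  next
    assume "j < count_list ?h Backward"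
    then obtain m where "m < bibfs_steps G s t A" "count_list (history A m) Backward = j"
      "A (history A m) = Backward"
      using history_count_attained by blast
    then show ?thesis
      using step_cost_le_explored[of m G s t A] by (simp add: min.coboundedI1 min.coboundedI2)
  qed
qed

lemma step_cost_greedy:
  "step_cost G s t h (greedy G s t h) =
     min (layer_cost G s (count_list h Forward)) (layer_cost G t (count_list h Backward))"
  by (auto simp: greedy_def)

theorem theorem5:
  fixes G :: "('a, 'b) pre_digraph" and s t :: 'a and d n :: nat and f :: "nat \<Rightarrow> nat"
  assumes "graph G" and "connected G"
    and "card (verts G) = n"
    and "diameter G = ereal (real d)"
    and "s \<in> verts G" and "t \<in> verts G"
    and "\<exists>A :: strategy. bibfs_explored G s t A = f n"
  shows "bibfs_explored G s t (greedy G s t) \<le> d * f n"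
proof -
  interpret graph G by fact
  obtain A where A: "bibfs_explored G s t A = f n"
    using assms(7) by blast
  define D where "D = (LEAST m. (s, t) \<in> arcs_ends G ^^ m)"
  obtain m where m: "m \<le> d" "(s, t) \<in> arcs_ends G ^^ m"
    using diameter_le_imp_short_walk[OF wf_digraph_axioms] assms(4-6) by (metis order_refl)
  have "D \<le> d"
    using m unfolding D_def by (meson Least_le le_trans)
  have steps: "bibfs_steps G s t B = D" for B
    unfolding D_def using bibfs_steps_eq[OF sym_arcs] m(2) by blast
  let ?g = "greedy G s t"
  \<comment> \<open>The bound is applied to \<open>A\<close> with the radii reached by greedy after
    \<open>k\<close> steps; they sum to \<open>k\<close>, and \<open>A\<close> also performs
    \<open>D > k\<close> steps.\<close>
  have "step_cost G s t (history ?g k) (?g (history ?g k)) \<le> f n" if "k < D" for k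
    unfolding step_cost_greedy A[symmetric]
    by (rule min_layer_cost_le_explored) (simp add: steps count_Forward_Backward that)
  then have "bibfs_explored G s t ?g \<le> D * f n"
    unfolding bibfs_explored_def steps by (intro order_trans[OF sum_bounded_above]) auto
  also have "\<dots> \<le> d * f n"
    using \<open>D \<le> d\<close> by simp
  finally show ?thesis .
qed

end
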